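(* Let $K:X\to Y$ be a linear, compact and injective operator between infinite-dimensional separable real Hilbert spaces, let $\{\phi_i\}_{i=1}^\infty$ be an orthonormal basis of $X$, let $\tau>0$ be fixed, and let $K_k$, $P_k$, $w_{k,i}$ and $\mathcal{R}_{W_k}$ be as defined in the context. Let $x^\dagger=\phi_j$ for some index $j$. For every $k\ge1$ with $\|P_k\phi_j\|\ge\tau$ there exists $\lambda_k\in Y$ such that $$K_k^*\lambda_k\in\partial\mathcal{R}_{W_k}(\phi_j).$$ Furthermore, if $$\sum_{i=1}^\infty\frac{(v_i,\phi_j)^2}{\sigma_i^2}<\infty,$$ then these $\lambda_k$ can be chosen such that $\|\lambda_k\|$ is bounded uniformly with respect to $k$ (over all $k$ with $\|P_k\phi_j\|\ge\tau$), and with this choice, for every such $k$, every $\alpha>0$, every $y^\delta\in Y$ and every $$x_{k,\alpha}\in\operatorname*{arg\,min}_{x\in X}\left\{\frac12\|K_kx-y^\delta\|^2+\alpha\,\mathcal{R}_{W_k}(x)\right\},$$ the Bregman distance $d_k=\mathcal{R}_{W_k}(x_{k,\alpha})-\mathcal{R}_{W_k}(\phi_j)-(K_k^*\lambda_k,x_{k,\alpha}-\phi_j)$ reads $$d_k=\mathcal{R}_{W_k}(x_{k,\alpha})-\mathcal{R}_{W_k}(\phi_j)-w_{k,j}^{-1}\left(P_k\phi_j,\,x_{k,\alpha}-\phi_j\right).$$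
   Context: $(\cdot,\cdot)$ and $\|\cdot\|$ denote the inner product and norm of $X$ or $Y$, according to context. Let $(v_i,u_i;\sigma_i)_{i\ge1}$ be a singular system of $K$, so that $Kx=\sum_{i=1}^\infty\sigma_i(x,v_i)u_i$ with $\sigma_1\ge\sigma_2\ge\cdots>0$, where $\{v_i\}$ is an orthonormal basis of $X$ ($K$ being injective) and $\{u_i\}$ is orthonormal in $Y$. The truncated operator is $K_kx=\sum_{i=1}^k\sigma_i(x,v_i)u_i$, with adjoint $K_k^*$, and $P_k$ is the orthogonal projection of $X$ onto $\mathcal{N}(K_k)^\perp=\mathrm{span}\{v_1,\ldots,v_k\}$. Given the threshold $\tau>0$, the weights are $w_{k,i}=\|P_k\phi_i\|$ if $\|P_k\phi_i\|\ge\tau$ and $w_{k,i}=\tau$ if $\|P_k\phi_i\|<\tau$. The functional $\mathcal{R}_{W_k}:X\to[0,\infty]$ is $\mathcal{R}_{W_k}(x)=\sum_{i=1}^\infty w_{k,i}|(x,\phi_i)|$, and $\partial\mathcal{R}_{W_k}$ denotes its convex subdifferential. *)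

theory Defs
  imports "HOL-Analysis.Analysis"
begin

(* All sequences are indexed from 0: the mathematical (v_i, u_i; sigma_i), phi_i, i >= 1, is entry
   i - 1 here.  The truncation level k is not shifted; it keeps the first k terms. *)

definition infinite_dimensional :: "'a::real_vector itself \<Rightarrow> bool" where
  "infinite_dimensional _ \<longleftrightarrow> \<not> (\<exists>B::'a set. finite B \<and> span B = UNIV)"

definition orthonormal_seq :: "(nat \<Rightarrow> 'a::real_inner) \<Rightarrow> bool" where
  "orthonormal_seq e \<longleftrightarrow> (\<forall>i j. e i \<bullet> e j = (if i = j then 1 else 0))"

definition orthonormal_basis :: "(nat \<Rightarrow> 'a::real_inner) \<Rightarrow> bool" where
  "orthonormal_basis e \<longleftrightarrow> orthonormal_seq e \<and> closure (span (range e)) = UNIV"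

definition compact_operator :: "('a::real_normed_vector \<Rightarrow> 'b::real_normed_vector) \<Rightarrow> bool" where
  "compact_operator K \<longleftrightarrow> linear K \<and> (\<forall>S. bounded S \<longrightarrow> compact (closure (K ` S)))"

(* Singular system of an injective operator: the v_i form a basis of the whole domain. *)
definition singular_system ::
  "('a::real_inner \<Rightarrow> 'b::real_inner) \<Rightarrow> (nat \<Rightarrow> 'a) \<Rightarrow> (nat \<Rightarrow> 'b) \<Rightarrow> (nat \<Rightarrow> real) \<Rightarrow> bool" where
  "singular_system K v u \<sigma> \<longleftrightarrow>
     orthonormal_basis v \<and> orthonormal_seq u \<and> decseq \<sigma> \<and> (\<forall>i. \<sigma> i > 0) \<and>
     (\<forall>x. (\<lambda>i. (\<sigma> i * (x \<bullet> v i)) *\<^sub>R u i) sums K x)"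

definition truncated_op ::
  "(nat \<Rightarrow> 'a::real_inner) \<Rightarrow> (nat \<Rightarrow> 'b::real_inner) \<Rightarrow> (nat \<Rightarrow> real) \<Rightarrow> nat \<Rightarrow> 'a \<Rightarrow> 'b" where
  "truncated_op v u \<sigma> k x = (\<Sum>i<k. (\<sigma> i * (x \<bullet> v i)) *\<^sub>R u i)"

(* Meaningful only if the orthogonal decomposition along S exists, e.g. if S is a closed subspace
   of a Hilbert space.  It is used below for the finite-dimensional space N(K_k)^\<bottom>. *)
definition orth_projection :: "'a::real_inner set \<Rightarrow> 'a \<Rightarrow> 'a" where
  "orth_projection S x = (THE p. p \<in> S \<and> x - p \<in> orthogonal_comp S)"

definition trunc_proj ::
  "(nat \<Rightarrow> 'a::real_inner) \<Rightarrow> (nat \<Rightarrow> 'b::real_inner) \<Rightarrow> (nat \<Rightarrow> real) \<Rightarrow> nat \<Rightarrow> 'a \<Rightarrow> 'a" where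
  "trunc_proj v u \<sigma> k = orth_projection (orthogonal_comp {x. truncated_op v u \<sigma> k x = 0})"

definition threshold_weight :: "real \<Rightarrow> ('a::real_inner \<Rightarrow> 'a) \<Rightarrow> (nat \<Rightarrow> 'a) \<Rightarrow> nat \<Rightarrow> real" where
  "threshold_weight \<tau> P \<phi> i = (if norm (P (\<phi> i)) \<ge> \<tau> then norm (P (\<phi> i)) else \<tau>)"

(* The functional takes values in [0,\<infinity>]; ereal rather than ennreal is used because differences
   and real inner products are combined with its values. *)
definition weighted_l1 :: "(nat \<Rightarrow> real) \<Rightarrow> (nat \<Rightarrow> 'a::real_inner) \<Rightarrow> 'a \<Rightarrow> ereal" where
  "weighted_l1 w \<phi> x = (\<Sum>i. ereal (w i * \<bar>x \<bullet> \<phi> i\<bar>))"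

(* Empty where f is not finite; elements of the dual are identified with vectors. *)
definition subdifferential :: "('a::real_inner \<Rightarrow> ereal) \<Rightarrow> 'a \<Rightarrow> 'a set" where
  "subdifferential f x =
     {\<xi>. \<bar>f x\<bar> \<noteq> \<infinity> \<and> (\<forall>z. f z \<ge> f x + ereal (\<xi> \<bullet> (z - x)))}"

definition tikhonov ::
  "('a::real_inner \<Rightarrow> 'b::real_inner) \<Rightarrow> 'b \<Rightarrow> real \<Rightarrow> ('a \<Rightarrow> ereal) \<Rightarrow> 'a \<Rightarrow> ereal" where
  "tikhonov A y \<alpha> R x = ereal ((norm (A x - y))\<^sup>2 / 2) + ereal \<alpha> * R x"

definition bregman_dist :: "('a::real_inner \<Rightarrow> ereal) \<Rightarrow> 'a \<Rightarrow> 'a \<Rightarrow> 'a \<Rightarrow> ereal" where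
  "bregman_dist R \<xi> x x0 = R x - R x0 - ereal (\<xi> \<bullet> (x - x0))"

end

(* The source element is explicit: Lambda_k = sum_{i<k} (phi_j, v_i) / (sigma_i w_{k,j}) u_i, for which
   K_k^* Lambda_k = P_k phi_j / ||P_k phi_j||.  Since P_k is a self-adjoint projection, Cauchy-Schwarz
   bounds the coefficient of this vector along phi_i by ||P_k phi_i|| <= w_{k,i}, with equality at
   i = j; such a vector is a subgradient of the weighted l1 functional at phi_j.  Because
   w_{k,j} >= tau, ||Lambda_k||^2 is at most the Picard series divided by tau^2. *)

theory Submission
  imports Defs
begin

lemma inner_sum_orthonormal:
  assumes "orthonormal_seq e"
  shows "(\<Sum>i<n. c i *\<^sub>R e i) \<bullet> e m = (if m < n then c m else 0)"
proof -
  have "(\<Sum>i<n. c i *\<^sub>R e i) \<bullet> e m = (\<Sum>i<n. if i = m then c i else 0)"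
    using assms unfolding inner_sum_left orthonormal_seq_def by (intro sum.cong) auto
  then show ?thesis by simp
qed

lemma inner_sum_sum_orthonormal:
  assumes "orthonormal_seq e"
  shows "(\<Sum>i<n. c i *\<^sub>R e i) \<bullet> (\<Sum>i<n. d i *\<^sub>R e i) = (\<Sum>i<n. c i * d i)"
proof -
  have "(\<Sum>i<n. c i *\<^sub>R e i) \<bullet> (\<Sum>m<n. d m *\<^sub>R e m)
      = (\<Sum>m<n. d m * ((\<Sum>i<n. c i *\<^sub>R e i) \<bullet> e m))"
    by (simp only: inner_sum_right[of "\<Sum>i<n. c i *\<^sub>R e i"] inner_scaleR_right)
  also have "\<dots> = (\<Sum>m<n. c m * d m)"
    by (rule sum.cong) (simp_all add: inner_sum_orthonormal[OF assms] mult.commute)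
  finally show ?thesis .
qed

lemma norm_sum_orthonormal:
  assumes "orthonormal_seq e"
  shows "(norm (\<Sum>i<n. c i *\<^sub>R e i))\<^sup>2 = (\<Sum>i<n. (c i)\<^sup>2)"
  unfolding power2_norm_eq_inner inner_sum_sum_orthonormal[OF assms]
  by (simp add: power2_eq_square)

text \<open>The residual \<open>z - ?p\<close> is orthogonal to the span of the first
  \<open>n\<close> vectors, which contains \<open>?p - y\<close>, so Pythagoras applies to
  \<open>z - y = (z - ?p) + (?p - y)\<close>.\<close>

lemma orthonormal_best_approximation:
  assumes e: "orthonormal_seq e" and y: "y \<in> span (e ` {..<n})"
  shows "norm (z - (\<Sum>i<n. (z \<bullet> e i) *\<^sub>R e i)) \<le> norm (z - y)"
proof -
  let ?p = "\<Sum>i<n. (z \<bullet> e i) *\<^sub>R e i"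
  have "?p \<in> span (e ` {..<n})"
    by (intro span_sum span_scale span_base) auto
  then have "?p - y \<in> span (e ` {..<n})" using y by (rule span_diff)
  moreover have "orthogonal (z - ?p) x" if "x \<in> e ` {..<n}" for x
    using that by (auto simp: orthogonal_def inner_diff_left inner_sum_orthonormal[OF e])
  ultimately have "orthogonal (z - ?p) (?p - y)"
    by (rule orthogonal_to_span)
  from norm_add_Pythagorean[OF this]
  have "(norm (z - y))\<^sup>2 = (norm (z - ?p))\<^sup>2 + (norm (?p - y))\<^sup>2" by simp
  then have "(norm (z - ?p))\<^sup>2 \<le> (norm (z - y))\<^sup>2" by simp
  then show ?thesis by (rule power2_le_imp_le) simp
qed

lemma span_range_initial_segment:
  fixes e :: "nat \<Rightarrow> 'a::real_vector"
  assumes "y \<in> span (range e)"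
  shows "\<exists>N. y \<in> span (e ` {..<N})"
  using assms
proof (induction rule: span_induct_alt)
  case base
  show ?case by (auto intro: span_zero)
next
  case (step c x y)
  then obtain N m where N: "y \<in> span (e ` {..<N})" and m: "x = e m" by auto
  \<comment> \<open>The successor is needed because \<open>{..<?M}\<close> excludes its endpoint and
    must contain \<open>m\<close>.\<close>
  let ?M = "max N (Suc m)"
  have "y \<in> span (e ` {..<?M})"
    using N by (rule subsetD[OF span_mono[OF image_mono], rotated]) auto
  moreover have "x \<in> span (e ` {..<?M})"
    unfolding m by (intro span_base) auto
  ultimately show ?case by (metis span_add span_scale)
qed

text \<open>Turns density of the span into the Fourier expansion. A vector of the span close to
  \<open>z\<close> already lies in the span of some initial segment, and from there on the partial
  Fourier sums approximate \<open>z\<close> at least as well, by best approximation.\<close>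

lemma orthonormal_basis_sums:
  assumes "orthonormal_basis e"
  shows "(\<lambda>i. (z \<bullet> e i) *\<^sub>R e i) sums z"
  unfolding sums_def
proof (rule LIMSEQ_I)
  fix r :: real assume r: "0 < r"
  have e: "orthonormal_seq e" and "z \<in> closure (span (range e))"
    using assms by (auto simp: orthonormal_basis_def)
  then obtain y where y: "y \<in> span (range e)" "dist y z < r"
    using r by (auto simp: closure_approachable)
  then obtain N where N: "y \<in> span (e ` {..<N})"
    using span_range_initial_segment by blast
  have "norm ((\<Sum>i<n. (z \<bullet> e i) *\<^sub>R e i) - z) < r" if "N \<le> n" for n
  proof -
    have "y \<in> span (e ` {..<n})"
      using N by (rule subsetD[OF span_mono[OF image_mono], rotated]) (use that in auto)
    from orthonormal_best_approximation[OF e this, of z] y(2) show ?thesis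
      by (simp add: dist_norm norm_minus_commute)
  qed
  then show "\<exists>N. \<forall>n\<ge>N. norm ((\<Sum>i<n. (z \<bullet> e i) *\<^sub>R e i) - z) < r" by blast
qed

text \<open>The right-hand side satisfies the defining identity of the adjoint, which determines it
  uniquely.\<close>

lemma adjoint_truncated_op:
  "adjoint (truncated_op v u \<sigma> k) l = (\<Sum>i<k. (\<sigma> i * (l \<bullet> u i)) *\<^sub>R v i)"
proof -
  have "adjoint (truncated_op v u \<sigma> k) = (\<lambda>l. \<Sum>i<k. (\<sigma> i * (l \<bullet> u i)) *\<^sub>R v i)"
    by (rule adjoint_unique)
      (auto simp: truncated_op_def inner_sum_left inner_sum_right inner_commute mult_ac
        intro!: sum.cong)
  then show ?thesis by simp
qed

text \<open>Resolves the definite description: two candidates differ by a vector lying both in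
  \<open>S\<close> and in its orthogonal complement, hence by zero.\<close>

lemma orth_projection_eqI:
  assumes S: "subspace S" and p: "p \<in> S" "x - p \<in> orthogonal_comp S"
  shows "orth_projection S x = p"
  unfolding orth_projection_def
proof (rule the_equality)
  fix q assume q: "q \<in> S \<and> x - q \<in> orthogonal_comp S"
  then have "p - q \<in> S" using S p by (auto intro: subspace_diff)
  moreover have "(x - q) - (x - p) \<in> orthogonal_comp S"
    by (rule subspace_diff[OF subspace_orthogonal_comp]) (use q p in auto)
  ultimately have "orthogonal (p - q) (p - q)"
    by (auto simp: orthogonal_comp_def)
  then show "q = p" by (simp add: orthogonal_self)
qed (use p in auto)

text \<open>Pairing with \<open>u i\<close> isolates the coefficient
  \<open>\<sigma> i * (x \<bullet> v i)\<close>, and \<open>\<sigma> i > 0\<close>; so the null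
  space consists of the vectors orthogonal to the first \<open>k\<close> of the \<open>v i\<close>.
  The sum lies in its complement and the residual in the null space itself.\<close>

lemma trunc_proj_eq:
  assumes v: "orthonormal_seq v" and u: "orthonormal_seq u" and \<sigma>: "\<And>i. \<sigma> i > 0"
  shows "trunc_proj v u \<sigma> k x = (\<Sum>i<k. (x \<bullet> v i) *\<^sub>R v i)" (is "_ = ?p")
proof -
  let ?N = "{x. truncated_op v u \<sigma> k x = 0}"
  have N: "?N = {x. \<forall>i<k. x \<bullet> v i = 0}"
  proof (intro Collect_cong iffI)
    fix y assume y: "truncated_op v u \<sigma> k y = 0"
    show "\<forall>i<k. y \<bullet> v i = 0"
    proof (intro allI impI)
      fix i assume "i < k"
      then have "truncated_op v u \<sigma> k y \<bullet> u i = \<sigma> i * (y \<bullet> v i)"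
        by (simp add: truncated_op_def inner_sum_orthonormal[OF u])
      with y \<sigma>[of i] show "y \<bullet> v i = 0" by simp
    qed
  qed (simp add: truncated_op_def)
  have "?p \<in> orthogonal_comp ?N"
    unfolding N by (auto simp: orthogonal_comp_def orthogonal_def inner_sum_right)
  moreover have "x - ?p \<in> ?N"
    unfolding N by (simp add: inner_diff_left inner_sum_orthonormal[OF v])
  \<comment> \<open>A set is always contained in its double orthogonal complement; this inclusion
    suffices here.\<close>
  then have "x - ?p \<in> orthogonal_comp (orthogonal_comp ?N)"
    by (rule subsetD[OF orthogonal_comp_subset])
  ultimately show ?thesis
    unfolding trunc_proj_def by (rule orth_projection_eqI[OF subspace_orthogonal_comp])
qed

lemma weighted_l1_basis:
  assumes "orthonormal_seq \<phi>"
  shows "weighted_l1 w \<phi> (\<phi> j) = ereal (w j)"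
proof -
  have "weighted_l1 w \<phi> (\<phi> j) = (\<Sum>i\<in>{j}. ereal (w i * \<bar>\<phi> j \<bullet> \<phi> i\<bar>))"
    unfolding weighted_l1_def
    using assms by (intro suminf_finite) (auto simp: orthonormal_seq_def zero_ereal_def)
  then show ?thesis using assms by (simp add: orthonormal_seq_def)
qed

text \<open>Expand \<open>z\<close> in the basis, bound each term of the inner product by the
  corresponding term of the functional, and pass to the limit. This also covers the case where the
  functional is infinite at \<open>z\<close>.\<close>

lemma inner_le_weighted_l1:
  assumes \<phi>: "orthonormal_basis \<phi>" and \<xi>: "\<And>i. \<bar>\<xi> \<bullet> \<phi> i\<bar> \<le> w i"
  shows "ereal (\<xi> \<bullet> z) \<le> weighted_l1 w \<phi> z"
proof -
  have "(\<lambda>n. \<xi> \<bullet> (\<Sum>i<n. (z \<bullet> \<phi> i) *\<^sub>R \<phi> i)) \<longlonglongrightarrow> \<xi> \<bullet> z"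
    using orthonormal_basis_sums[OF \<phi>, of z] unfolding sums_def by (intro tendsto_intros)
  then have "(\<lambda>n. ereal (\<xi> \<bullet> (\<Sum>i<n. (z \<bullet> \<phi> i) *\<^sub>R \<phi> i))) \<longlonglongrightarrow> ereal (\<xi> \<bullet> z)"
    by simp
  moreover have "ereal (\<xi> \<bullet> (\<Sum>i<n. (z \<bullet> \<phi> i) *\<^sub>R \<phi> i)) \<le> weighted_l1 w \<phi> z" for n
  proof -
    have "\<xi> \<bullet> (\<Sum>i<n. (z \<bullet> \<phi> i) *\<^sub>R \<phi> i) = (\<Sum>i<n. (\<xi> \<bullet> \<phi> i) * (z \<bullet> \<phi> i))"
      by (simp add: inner_sum_right mult.commute)
    also have "\<dots> \<le> (\<Sum>i<n. w i * \<bar>z \<bullet> \<phi> i\<bar>)"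
    proof (rule sum_mono)
      fix i
      have "(\<xi> \<bullet> \<phi> i) * (z \<bullet> \<phi> i) \<le> \<bar>\<xi> \<bullet> \<phi> i\<bar> * \<bar>z \<bullet> \<phi> i\<bar>"
        by (metis abs_ge_self abs_mult)
      also have "\<dots> \<le> w i * \<bar>z \<bullet> \<phi> i\<bar>"
        by (intro mult_right_mono \<xi>) simp
      finally show "(\<xi> \<bullet> \<phi> i) * (z \<bullet> \<phi> i) \<le> w i * \<bar>z \<bullet> \<phi> i\<bar>" .
    qed
    finally have "ereal (\<xi> \<bullet> (\<Sum>i<n. (z \<bullet> \<phi> i) *\<^sub>R \<phi> i)) \<le> (\<Sum>i<n. ereal (w i * \<bar>z \<bullet> \<phi> i\<bar>))"
      by simp
    also have "\<dots> \<le> weighted_l1 w \<phi> z"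
      unfolding weighted_l1_def
      \<comment> \<open>The bound on \<xi> forces \<open>w i \<ge> 0\<close>, so the terms are
        nonnegative and partial sums stay below the series.\<close>
      using order_trans[OF abs_ge_zero \<xi>] by (intro sum_le_suminf) (auto intro: summable_ereal_pos)
    finally show ?thesis .
  qed
  ultimately show ?thesis by (rule Lim_bounded[OF _ allI[OF impI]])
qed

text \<open>Since \<xi> pairs with \<open>\<phi> j\<close> to the value \<open>w j\<close> of the
  functional there, the constants in the subgradient inequality cancel and the previous bound
  remains.\<close>

lemma weighted_l1_subgradient:
  assumes \<phi>: "orthonormal_basis \<phi>" and \<xi>: "\<And>i. \<bar>\<xi> \<bullet> \<phi> i\<bar> \<le> w i" and "\<xi> \<bullet> \<phi> j = w j"
  shows "\<xi> \<in> subdifferential (weighted_l1 w \<phi>) (\<phi> j)"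
proof -
  have "weighted_l1 w \<phi> (\<phi> j) = ereal (w j)"
    using \<phi> by (simp add: weighted_l1_basis orthonormal_basis_def)
  then show ?thesis
    using inner_le_weighted_l1[OF \<phi> \<xi>] assms(3)
    by (simp add: subdifferential_def inner_diff_right)
qed

theorem proposition3p9:
  fixes K :: "'a::{real_inner, complete_space} \<Rightarrow> 'b::{real_inner, complete_space}"
    and v :: "nat \<Rightarrow> 'a" and u :: "nat \<Rightarrow> 'b" and \<sigma> :: "nat \<Rightarrow> real"
    and \<phi> :: "nat \<Rightarrow> 'a" and \<tau> :: real and j :: nat
    and K_tr :: "nat \<Rightarrow> 'a \<Rightarrow> 'b" and P :: "nat \<Rightarrow> 'a \<Rightarrow> 'a"
    and w :: "nat \<Rightarrow> nat \<Rightarrow> real" and R :: "nat \<Rightarrow> 'a \<Rightarrow> ereal"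
  assumes "separable_space (euclidean :: 'a topology)"
    and "separable_space (euclidean :: 'b topology)"
    and "infinite_dimensional TYPE('a)"
    and "infinite_dimensional TYPE('b)"
    and "compact_operator K"
    and "inj K"
    and "singular_system K v u \<sigma>"
    and "orthonormal_basis \<phi>"
    and "\<tau> > 0"
  defines "K_tr \<equiv> truncated_op v u \<sigma>"
    and "P \<equiv> trunc_proj v u \<sigma>"
    and "w \<equiv> (\<lambda>k. threshold_weight \<tau> (P k) \<phi>)"
    and "R \<equiv> (\<lambda>k. weighted_l1 (w k) \<phi>)"
  shows "(\<forall>k\<ge>1. norm (P k (\<phi> j)) \<ge> \<tau> \<longrightarrow>
            (\<exists>l. adjoint (K_tr k) l \<in> subdifferential (R k) (\<phi> j))) \<and>
         (summable (\<lambda>i. (v i \<bullet> \<phi> j)\<^sup>2 / (\<sigma> i)\<^sup>2) \<longrightarrow>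
            (\<exists>\<Lambda> :: nat \<Rightarrow> 'b.
               (\<forall>k\<ge>1. norm (P k (\<phi> j)) \<ge> \<tau> \<longrightarrow>
                  adjoint (K_tr k) (\<Lambda> k) \<in> subdifferential (R k) (\<phi> j)) \<and>
               (\<exists>C. \<forall>k\<ge>1. norm (P k (\<phi> j)) \<ge> \<tau> \<longrightarrow> norm (\<Lambda> k) \<le> C) \<and>
               (\<forall>k\<ge>1. norm (P k (\<phi> j)) \<ge> \<tau> \<longrightarrow>
                  (\<forall>\<alpha>>0. \<forall>y x. is_arg_min (tikhonov (K_tr k) y \<alpha> (R k)) (\<lambda>_. True) x \<longrightarrow>
                     bregman_dist (R k) (adjoint (K_tr k) (\<Lambda> k)) x (\<phi> j)
                       = R k x - R k (\<phi> j)
                         - ereal (inverse (w k j) * (P k (\<phi> j) \<bullet> (x - \<phi> j)))))))"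
proof -
  have v: "orthonormal_seq v" and u: "orthonormal_seq u" and \<sigma>: "\<And>i. \<sigma> i > 0"
    using assms(7) by (auto simp: singular_system_def orthonormal_basis_def)
  have \<phi>: "orthonormal_basis \<phi>" by fact
  have P: "P k x = (\<Sum>i<k. (x \<bullet> v i) *\<^sub>R v i)" for k x
    unfolding P_def using v u \<sigma> by (rule trunc_proj_eq)
  \<comment> \<open>\<open>P k\<close> is self-adjoint and idempotent; both sides equal the same sum
    of products of coefficients.\<close>
  have P_inner: "P k x \<bullet> y = P k x \<bullet> P k y" for k x y
  proof -
    have "P k x \<bullet> P k y = (\<Sum>i<k. (x \<bullet> v i) * (y \<bullet> v i))"
      unfolding P by (rule inner_sum_sum_orthonormal[OF v])
    moreover have "P k x \<bullet> y = (\<Sum>i<k. (x \<bullet> v i) * (y \<bullet> v i))"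
      unfolding P inner_sum_left by (simp add: inner_commute)
    ultimately show ?thesis by simp
  qed
  \<comment> \<open>Chosen independently of the Picard condition, so one family serves both the
    existence claim and the bounded choice.\<close>
  define \<Lambda> where "\<Lambda> k = (\<Sum>i<k. ((\<phi> j \<bullet> v i) / (\<sigma> i * w k j)) *\<^sub>R u i)" for k
  have adj: "adjoint (K_tr k) (\<Lambda> k) = inverse (w k j) *\<^sub>R P k (\<phi> j)" for k
  proof -
    have "\<sigma> i * (\<Lambda> k \<bullet> u i) = inverse (w k j) * (\<phi> j \<bullet> v i)" if "i < k" for i
      using that \<sigma>[of i] by (simp add: \<Lambda>_def inner_sum_orthonormal[OF u] field_simps)
    then show ?thesis
      by (simp add: K_tr_def adjoint_truncated_op P scaleR_sum_right)
  qed
  have sub: "adjoint (K_tr k) (\<Lambda> k) \<in> subdifferential (R k) (\<phi> j)"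
    if k: "norm (P k (\<phi> j)) \<ge> \<tau>" for k
  proof -
    \<comment> \<open>Above the threshold the weight is the norm itself, which makes the vector in
      \<open>adj\<close> a unit vector.\<close>
    have wj: "w k j = norm (P k (\<phi> j))" and pos: "w k j > 0"
      using k \<open>\<tau> > 0\<close> by (auto simp: w_def threshold_weight_def)
    have inner: "adjoint (K_tr k) (\<Lambda> k) \<bullet> \<phi> i = inverse (w k j) * (P k (\<phi> j) \<bullet> P k (\<phi> i))" for i
      by (simp add: adj P_inner[of k "\<phi> j" "\<phi> i"])
    show ?thesis
      unfolding R_def
    proof (rule weighted_l1_subgradient[OF \<phi>])
      fix i
      have "\<bar>P k (\<phi> j) \<bullet> P k (\<phi> i)\<bar> \<le> w k j * norm (P k (\<phi> i))"
        unfolding wj by (rule Cauchy_Schwarz_ineq2)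
      then have "\<bar>adjoint (K_tr k) (\<Lambda> k) \<bullet> \<phi> i\<bar> \<le> norm (P k (\<phi> i))"
        using pos by (simp add: inner abs_mult field_simps)
      \<comment> \<open>Both branches of the threshold dominate the norm.\<close>
      also have "\<dots> \<le> w k i" by (simp add: w_def threshold_weight_def)
      finally show "\<bar>adjoint (K_tr k) (\<Lambda> k) \<bullet> \<phi> i\<bar> \<le> w k i" .
    next
      show "adjoint (K_tr k) (\<Lambda> k) \<bullet> \<phi> j = w k j"
        using pos unfolding inner
        by (simp flip: power2_norm_eq_inner wj add: power2_eq_square)
    qed
  qed
  have bound: "norm (\<Lambda> k) \<le> sqrt (\<Sum>i. (v i \<bullet> \<phi> j)\<^sup>2 / (\<sigma> i)\<^sup>2) / \<tau>" (is "_ \<le> sqrt ?S / \<tau>")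
    if summ: "summable (\<lambda>i. (v i \<bullet> \<phi> j)\<^sup>2 / (\<sigma> i)\<^sup>2)" and k: "norm (P k (\<phi> j)) \<ge> \<tau>" for k
  proof -
    have w: "w k j \<ge> \<tau>"
      using k by (simp add: w_def threshold_weight_def)
    have "(norm (\<Lambda> k))\<^sup>2 = (\<Sum>i<k. (v i \<bullet> \<phi> j)\<^sup>2 / (\<sigma> i)\<^sup>2) / (w k j)\<^sup>2"
      unfolding \<Lambda>_def norm_sum_orthonormal[OF u] sum_divide_distrib
      by (simp add: power_divide power_mult_distrib inner_commute)
    \<comment> \<open>The numerator is a partial sum of a nonnegative series, and the denominator
      satisfies \<open>w k j \<ge> \<tau>\<close>; the resulting bound is free of
      \<open>k\<close>.\<close>
    also have "\<dots> \<le> ?S / \<tau>\<^sup>2"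
      using w \<open>\<tau> > 0\<close> summ
      by (intro frac_le sum_le_suminf power_mono suminf_nonneg) auto
    also have "\<dots> = (sqrt ?S / \<tau>)\<^sup>2"
      using summ by (simp add: power_divide suminf_nonneg)
    finally show ?thesis
      by (rule power2_le_imp_le) (use summ \<open>\<tau> > 0\<close> in \<open>simp add: suminf_nonneg\<close>)
  qed
  \<comment> \<open>\<Lambda> enters the Bregman distance only through its adjoint image, which
    \<open>adj\<close> rewrites.\<close>
  have breg: "bregman_dist (R k) (adjoint (K_tr k) (\<Lambda> k)) x (\<phi> j)
      = R k x - R k (\<phi> j) - ereal (inverse (w k j) * (P k (\<phi> j) \<bullet> (x - \<phi> j)))" for k x
    by (simp add: bregman_dist_def adj)
  show ?thesis
  proof (intro conjI impI exI[of _ \<Lambda>])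
    assume "summable (\<lambda>i. (v i \<bullet> \<phi> j)\<^sup>2 / (\<sigma> i)\<^sup>2)"
    then show "\<exists>C. \<forall>k\<ge>1. norm (P k (\<phi> j)) \<ge> \<tau> \<longrightarrow> norm (\<Lambda> k) \<le> C"
      using bound by blast
  qed (use sub breg in blast)+
qed

end
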